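(* If $p \ge 3$ and $n \ge 2$ are integers, then the game domination number $\gamma_{\rm g}(S_p^n)$ and the Staller start game domination number $\gamma_{\rm g}'(S_p^n)$ of the Sierpiński graph $S_p^n$ satisfy $$(2p-3)p^{n-2} \le \gamma_{\rm g}(S_p^n) \le (2p-2)p^{n-2} \quad\text{and}\quad (2p-3)p^{n-2} \le \gamma_{\rm g}'(S_p^n) \le (2p-2)p^{n-2}.$$
   Context: Write $[p]=\{1,\dots,p\}$. For $p\ge 3$ and $n\ge 1$, the Sierpiński graph $S_p^n$ has vertex set $[p]^n$, with $(i_1,\dots,i_n)$ written as $i_1\cdots i_n$. Vertices $i_1\cdots i_n$ and $j_1\cdots j_n$ are adjacent if there exists an index $h\in\{1,\dots,n\}$ such that (i) $i_t=j_t$ for every $t<h$, (ii) $i_h\ne j_h$, and (iii) $i_t=j_h$ and $j_t=i_h$ for every $t>h$. A vertex dominates itself and its neighbours. The domination game on a graph $G$ is played by two players, Dominator and Staller, who alternately choose vertices of $G$ such that each newly chosen vertex dominates at least one vertex not dominated by the previously chosen vertices. The game ends when no such vertex is available. Dominator wants the total number of chosen vertices (moves) to be as small as possible, Staller wants it to be as large as possible. The game domination number $\gamma_{\rm g}(G)$ is the number of moves when Dominator moves first (D-game) and both players play optimally. The Staller start game domination number $\gamma_{\rm g}'(G)$ is the number of moves when Staller moves first (S-game) and both players play optimally. *)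

theory Defs
  imports "Graph_Theory.Pair_Digraph"
begin

text \<open>A finite simple graph is a \<^locale>\<open>pair_graph\<close>: a finite loop-free pair digraph whose
  arc relation is symmetric. Vertices of the Sierpinski graph are words of length \<open>n\<close> over
  \<open>{1..p}\<close>; the word \<open>i\<^sub>1\<dots>i\<^sub>n\<close> is a list, so the position \<open>h\<close> of the usual definition
  is the list index \<open>h - 1\<close>.\<close>

definition sierpinski_adj :: "nat \<Rightarrow> nat list \<Rightarrow> nat list \<Rightarrow> bool" where
  "sierpinski_adj n u v \<longleftrightarrow>
     (\<exists>h<n. (\<forall>t<h. u ! t = v ! t) \<and> u ! h \<noteq> v ! h \<and>
            (\<forall>t. h < t \<and> t < n \<longrightarrow> u ! t = v ! h \<and> v ! t = u ! h))"

definition sierpinski_graph :: "nat \<Rightarrow> nat \<Rightarrow> nat list pair_pre_digraph" where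
  "sierpinski_graph p n =
     (let V = {w. length w = n \<and> set w \<subseteq> {1..p}}
      in \<lparr> pverts = V, parcs = {(u, v). u \<in> V \<and> v \<in> V \<and> sierpinski_adj n u v} \<rparr>)"

lemma pair_graph_sierpinski_graph: "pair_graph (sierpinski_graph p n)"
proof
  show "finite (pverts (sierpinski_graph p n))"
    using finite_lists_length_eq[of "{1..p}" n]
    by (simp add: sierpinski_graph_def Let_def conj_commute)
  then have "finite (pverts (sierpinski_graph p n) \<times> pverts (sierpinski_graph p n))"
    by simp
  moreover have "parcs (sierpinski_graph p n)
      \<subseteq> pverts (sierpinski_graph p n) \<times> pverts (sierpinski_graph p n)"
    unfolding sierpinski_graph_def Let_def by auto
  ultimately show "finite (parcs (sierpinski_graph p n))"
    by (rule rev_finite_subset)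
  have adj_sym: "sierpinski_adj n v u" if adj: "sierpinski_adj n u v" for u v
  proof -
    from adj obtain h where "h < n" and "\<forall>t<h. u ! t = v ! t" and "u ! h \<noteq> v ! h"
      and "\<forall>t. h < t \<and> t < n \<longrightarrow> u ! t = v ! h \<and> v ! t = u ! h"
      unfolding sierpinski_adj_def by blast
    then show ?thesis
      unfolding sierpinski_adj_def by (intro exI[of _ h]) auto
  qed
  show "symmetric (with_proj (sierpinski_graph p n))"
    unfolding symmetric_def
  proof (rule symI)
    fix u v
    assume "(u, v) \<in> arcs_ends (with_proj (sierpinski_graph p n))"
    then show "(v, u) \<in> arcs_ends (with_proj (sierpinski_graph p n))"
      by (simp add: arcs_ends_def arc_to_ends_def sierpinski_graph_def Let_def adj_sym)
  qed
next
  fix e assume "e \<in> parcs (sierpinski_graph p n)"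
  then have e: "fst e \<in> pverts (sierpinski_graph p n)" "snd e \<in> pverts (sierpinski_graph p n)"
    and adj: "sierpinski_adj n (fst e) (snd e)"
    unfolding sierpinski_graph_def Let_def by auto
  show "fst e \<in> pverts (sierpinski_graph p n)" "snd e \<in> pverts (sierpinski_graph p n)"
    by (fact e)+
  show "fst e \<noteq> snd e"
    using adj unfolding sierpinski_adj_def by metis
qed

definition closed_neighbourhood :: "'a pair_pre_digraph \<Rightarrow> 'a \<Rightarrow> 'a set" where
  "closed_neighbourhood G v = insert v {w. (v, w) \<in> parcs G}"

definition dominated :: "'a pair_pre_digraph \<Rightarrow> 'a set \<Rightarrow> 'a set" where
  "dominated G C = (\<Union>v\<in>C. closed_neighbourhood G v)"

definition legal_moves :: "'a pair_pre_digraph \<Rightarrow> 'a set \<Rightarrow> 'a set" where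
  "legal_moves G C = {v \<in> pverts G. \<not> closed_neighbourhood G v \<subseteq> dominated G C}"

lemma legal_moves_not_chosen: "v \<in> legal_moves G C \<Longrightarrow> v \<in> pverts G - C"
  by (auto simp: legal_moves_def dominated_def)

datatype player = Dominator | Staller

fun opponent :: "player \<Rightarrow> player" where
  "opponent Dominator = Staller"
| "opponent Staller = Dominator"

fun best :: "player \<Rightarrow> nat set \<Rightarrow> nat" where
  "best Dominator A = Min A"
| "best Staller A = Max A"

text \<open>\<open>optimal_moves G P C\<close> is the number of further moves under optimal play when the vertices
  in \<open>C\<close> have already been chosen and player \<open>P\<close> is to move. The guard on the finiteness of \<open>G\<close>
  only serves termination; infinite graphs get the dummy value \<open>0\<close>.\<close>

function optimal_moves :: "'a pair_pre_digraph \<Rightarrow> player \<Rightarrow> 'a set \<Rightarrow> nat" where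
  "optimal_moves G P C =
     (if infinite (pverts G) \<or> legal_moves G C = {} then 0
      else 1 + best P ((\<lambda>v. optimal_moves G (opponent P) (insert v C)) ` legal_moves G C))"
  by pat_completeness auto
termination
proof (relation "measure (\<lambda>(G, P, C). card (pverts G - C))", goal_cases)
  case (2 G P C v)
  then have "finite (pverts G - C)" and "v \<in> pverts G - C"
    using legal_moves_not_chosen[of v G C] by auto
  then have "card (pverts G - insert v C) < card (pverts G - C)"
    by (intro psubset_card_mono) auto
  then show ?case by simp
qed simp

declare optimal_moves.simps [simp del]

definition game_domination_number :: "'a pair_pre_digraph \<Rightarrow> nat" where
  "game_domination_number G = optimal_moves G Dominator {}"

definition staller_start_game_domination_number :: "'a pair_pre_digraph \<Rightarrow> nat" where
  "staller_start_game_domination_number G = optimal_moves G Staller {}"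

end

theory Submission
  imports Defs
begin

text \<open>The vertices of \<open>S\<^sub>p\<^sup>n\<close> with a common prefix of length \<open>n - 1\<close> form a clique, and those with
  a common prefix of length \<open>n - 2\<close> form a copy of \<open>S\<^sub>p\<^sup>2\<close>, made of \<open>p\<close> cliques. Distinct copies
  are joined only at diagonal vertices, the words ending in two equal letters. A clique is
  completely dominated once one of its vertices has been chosen. A move in a completely
  dominated clique is called wasted: the only vertex that it newly dominates is its neighbour in
  another clique, and that clique stays unplayed. Dominator wants to play new cliques, Staller wants to waste moves.

  Each bound comes from a potential that is a sum over the \<open>p\<^sup>n\<^sup>-\<^sup>2\<close> copies and that one player
  controls by answering in the copy to which the opponent's last move is charged.

  Upper bound (lemma \<open>optimal_moves_upper\<close>). If Dominator always plays an unplayed clique, a copy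
  costs at most two moves per clique. Two moves per copy are saved. If Staller plays a clique of
  the copy, one clique is missing from Dominator's share. If Staller never does, Dominator directs
  all moves of a copy into one target clique. When the other cliques are played, at most the
  diagonal vertex of the target is undominated, so at most one move is left. If Staller opened
  the copy, by a wasted move that dominates a diagonal vertex, the target is chosen such that
  this vertex belongs to it, and no move is left.

  Lower bound (lemma \<open>optimal_moves_lower\<close>). Whenever Dominator plays a clique, Staller can
  waste a move from that clique into another unplayed one, until fewer than two unplayed cliques
  are left. This gives two moves for each of the first \<open>p - 2\<close> cliques and at least one more.
  When Staller has to move and can waste nothing, Staller plays a diagonal vertex of an unplayed
  clique. This opens a wasted move into every other unplayed clique, which makes up for the clique
  given away.\<close>

section \<open>Potentials bound the length of the domination game\<close>

lemma finite_legal_moves: "finite (pverts G) \<Longrightarrow> finite (legal_moves G C)"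
  by (auto simp: legal_moves_def)

lemma optimal_moves_end: "legal_moves G C = {} \<Longrightarrow> optimal_moves G P C = 0"
  by (simp add: optimal_moves.simps)

lemma optimal_moves_Dominator_le:
  assumes "finite (pverts G)" "v \<in> legal_moves G C"
  shows "optimal_moves G Dominator C \<le> Suc (optimal_moves G Staller (insert v C))"
  using assms by (auto simp: optimal_moves.simps[of G Dominator C] finite_legal_moves intro!: Min_le)

lemma optimal_moves_Staller_ge:
  assumes "finite (pverts G)" "v \<in> legal_moves G C"
  shows "Suc (optimal_moves G Dominator (insert v C)) \<le> optimal_moves G Staller C"
  using assms by (auto simp: optimal_moves.simps[of G Staller C] finite_legal_moves intro!: Max_ge)

lemma optimal_moves_Staller_leI:
  assumes "finite (pverts G)"
    and "\<And>v. v \<in> legal_moves G C \<Longrightarrow> Suc (optimal_moves G Dominator (insert v C)) \<le> k"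
  shows "optimal_moves G Staller C \<le> k"
proof (cases "legal_moves G C = {}")
  case False
  let ?A = "(\<lambda>v. optimal_moves G Dominator (insert v C)) ` legal_moves G C"
  have "Max ?A \<in> ?A"
    using False assms(1) by (intro Max_in) (auto simp: finite_legal_moves)
  then show ?thesis
    using assms False by (auto simp: optimal_moves.simps[of G Staller C])
qed (simp add: optimal_moves_end)

lemma optimal_moves_Dominator_geI:
  assumes "finite (pverts G)" "legal_moves G C \<noteq> {}"
    and "\<And>v. v \<in> legal_moves G C \<Longrightarrow> k \<le> Suc (optimal_moves G Staller (insert v C))"
  shows "k \<le> optimal_moves G Dominator C"
proof -
  let ?A = "(\<lambda>v. optimal_moves G Staller (insert v C)) ` legal_moves G C"
  have "Min ?A \<in> ?A"
    using assms(1,2) by (intro Min_in) (auto simp: finite_legal_moves)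
  then show ?thesis
    using assms by (auto simp: optimal_moves.simps[of G Dominator C])
qed

lemma legal_move_in_verts: "v \<in> legal_moves G C \<Longrightarrow> v \<in> pverts G"
  by (simp add: legal_moves_def)

lemma legal_move_decreases:
  assumes "finite (pverts G)" "v \<in> legal_moves G C"
  shows "card (pverts G - insert v C) < card (pverts G - C)"
  using assms legal_moves_not_chosen[of v G C] by (intro psubset_card_mono) auto

text \<open>A potential that Dominator can lower by one with any free move and, whatever Staller
  does, by two per exchange of moves pays for every move that is still to come. The second
  condition speaks of Staller's move and the reply together because a move of Staller alone
  need not lower the potential.\<close>

lemma optimal_moves_le_potential:
  fixes f :: "'a set \<Rightarrow> nat"
  assumes fin: "finite (pverts G)"
    and free: "\<And>C. \<lbrakk>C \<subseteq> pverts G; legal_moves G C \<noteq> {}\<rbrakk>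
      \<Longrightarrow> \<exists>v\<in>legal_moves G C. f (insert v C) + 1 \<le> f C"
    and reply: "\<And>C v. \<lbrakk>C \<subseteq> pverts G; v \<in> legal_moves G C; legal_moves G (insert v C) \<noteq> {}\<rbrakk>
      \<Longrightarrow> \<exists>w\<in>legal_moves G (insert v C). f (insert w (insert v C)) + 2 \<le> f C"
    and C: "C \<subseteq> pverts G"
  shows "optimal_moves G P C \<le> f C"
proof -
  have S: "optimal_moves G Staller C \<le> f C" if "C \<subseteq> pverts G" for C
    using that
  proof (induction "card (pverts G - C)" arbitrary: C rule: less_induct)
    case less
    show ?case
    proof (rule optimal_moves_Staller_leI[OF fin])
      fix v assume v: "v \<in> legal_moves G C"
      have vC: "insert v C \<subseteq> pverts G"
        using less.prems legal_move_in_verts[OF v] by simp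
      show "Suc (optimal_moves G Dominator (insert v C)) \<le> f C"
      proof (cases "legal_moves G (insert v C) = {}")
        case True
        then show ?thesis
          using free[OF less.prems] v by (fastforce simp: optimal_moves_end)
      next
        case False
        then obtain w where w: "w \<in> legal_moves G (insert v C)"
          "f (insert w (insert v C)) + 2 \<le> f C"
          using reply[OF less.prems v] by blast
        have "optimal_moves G Staller (insert w (insert v C)) \<le> f (insert w (insert v C))"
          using legal_move_decreases[OF fin v] legal_move_decreases[OF fin w(1)]
            vC legal_move_in_verts[OF w(1)]
          by (intro less.hyps) auto
        then show ?thesis
          using optimal_moves_Dominator_le[OF fin w(1)] w(2) by linarith
      qed
    qed
  qed
  show ?thesis
  proof (cases P)
    case Dominator
    show ?thesis
    proof (cases "legal_moves G C = {}")
      case False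
      then obtain v where v: "v \<in> legal_moves G C" "f (insert v C) + 1 \<le> f C"
        using free[OF C] by blast
      have "optimal_moves G Staller (insert v C) \<le> f (insert v C)"
        using C legal_move_in_verts[OF v(1)] by (intro S) auto
      then show ?thesis
        using optimal_moves_Dominator_le[OF fin v(1)] v(2) Dominator by simp
    qed (simp add: optimal_moves_end)
  qed (use S[OF C] in simp)
qed

text \<open>The mirror image for Staller. A potential of at most one asks for no reply, because
  Dominator's own move already pays for it.\<close>

lemma optimal_moves_ge_potential:
  fixes f :: "'a set \<Rightarrow> nat"
  assumes fin: "finite (pverts G)"
    and free: "\<And>C. \<lbrakk>C \<subseteq> pverts G; f C > 0\<rbrakk> \<Longrightarrow> \<exists>v\<in>legal_moves G C. f C \<le> f (insert v C) + 1"
    and reply: "\<And>C v. \<lbrakk>C \<subseteq> pverts G; v \<in> legal_moves G C; f C > 1\<rbrakk>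
      \<Longrightarrow> \<exists>w\<in>legal_moves G (insert v C). f C \<le> f (insert w (insert v C)) + 2"
    and C: "C \<subseteq> pverts G"
  shows "f C \<le> optimal_moves G P C"
proof -
  have D: "f C \<le> optimal_moves G Dominator C" if "C \<subseteq> pverts G" for C
    using that
  proof (induction "card (pverts G - C)" arbitrary: C rule: less_induct)
    case less
    show ?case
    proof (cases "f C = 0")
      case False
      show ?thesis
      proof (rule optimal_moves_Dominator_geI[OF fin])
        show "legal_moves G C \<noteq> {}"
          using free[OF less.prems] False by blast
        fix v assume v: "v \<in> legal_moves G C"
        have vC: "insert v C \<subseteq> pverts G"
          using less.prems legal_move_in_verts[OF v] by simp
        show "f C \<le> Suc (optimal_moves G Staller (insert v C))"
        proof (cases "f C \<le> 1")
          case False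
          then obtain w where w: "w \<in> legal_moves G (insert v C)"
            "f C \<le> f (insert w (insert v C)) + 2"
            using reply[OF less.prems v] by auto
          have "f (insert w (insert v C)) \<le> optimal_moves G Dominator (insert w (insert v C))"
            using legal_move_decreases[OF fin v] legal_move_decreases[OF fin w(1)]
              vC legal_move_in_verts[OF w(1)]
            by (intro less.hyps) auto
          then show ?thesis
            using optimal_moves_Staller_ge[OF fin w(1)] w(2) by linarith
        qed simp
      qed
    qed simp
  qed
  show ?thesis
  proof (cases P)
    case Staller
    show ?thesis
    proof (cases "f C = 0")
      case False
      then obtain v where v: "v \<in> legal_moves G C" "f C \<le> f (insert v C) + 1"
        using free[OF C] by blast
      have "f (insert v C) \<le> optimal_moves G Dominator (insert v C)"
        using C legal_move_in_verts[OF v(1)] by (intro D) auto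
      then show ?thesis
        using optimal_moves_Staller_ge[OF fin v(1)] v(2) Staller by simp
    qed simp
  qed (use D[OF C] in simp)
qed

section \<open>Copies of the two-dimensional Sierpinski graph\<close>

text \<open>All that matters of \<open>S\<^sub>p\<^sup>n\<close> is that it consists of copies of \<open>S\<^sub>p\<^sup>2\<close>, indexed by \<open>Cs\<close>, that
  are joined to each other at diagonal vertices \<open>vx c i i\<close> only. The vertices \<open>vx c i j\<close> with
  fixed \<open>c\<close> and \<open>i\<close> form the \<open>i\<close>-th clique of the copy \<open>c\<close>, and \<open>vx c i j\<close> is joined to
  \<open>vx c j i\<close> in the \<open>j\<close>-th clique.\<close>

locale sierpinski_copies = pair_graph G
  for G :: "'v pair_pre_digraph" +
  fixes Cs :: "'c set" and I :: "'i set" and vx :: "'c \<Rightarrow> 'i \<Rightarrow> 'i \<Rightarrow> 'v"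
  assumes finite_Cs: "finite Cs" and finite_I: "finite I" and card_I: "card I \<ge> 3"
    and verts_eq: "pverts G = {vx c i j | c i j. c \<in> Cs \<and> i \<in> I \<and> j \<in> I}"
    and vx_eq [simp]: "vx c i j = vx c' i' j' \<longleftrightarrow> c = c' \<and> i = i' \<and> j = j'"
    and same_clique: "\<lbrakk>c \<in> Cs; i \<in> I; j \<in> I; j' \<in> I\<rbrakk>
      \<Longrightarrow> vx c i j \<in> closed_neighbourhood G (vx c i j')"
    and other_clique: "\<lbrakk>c \<in> Cs; i \<in> I; j \<in> I; i' \<in> I; j' \<in> I; i \<noteq> i'\<rbrakk>
      \<Longrightarrow> vx c i j \<in> closed_neighbourhood G (vx c i' j') \<longleftrightarrow> j = i' \<and> j' = i"
    and other_copy: "\<lbrakk>c \<in> Cs; c' \<in> Cs; i \<in> I; j \<in> I; i' \<in> I; j' \<in> I; c \<noteq> c';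
        vx c i j \<in> closed_neighbourhood G (vx c' i' j')\<rbrakk> \<Longrightarrow> i = j"
begin

definition played :: "'v set \<Rightarrow> 'c \<Rightarrow> 'i set" where
  "played C c = {i \<in> I. \<exists>j\<in>I. vx c i j \<in> C}"

definition finished :: "'v set \<Rightarrow> 'c \<Rightarrow> bool" where
  "finished C c \<longleftrightarrow> (\<forall>i\<in>I. \<forall>j\<in>I. vx c i j \<in> dominated G C)"

text \<open>Every played clique has already dominated its neighbour in a target. Apart from the
  diagonal one, the undominated vertices of a target are neighbours of unplayed cliques, so it
  may get completely dominated without ever being played.\<close>

definition target :: "'v set \<Rightarrow> 'c \<Rightarrow> 'i \<Rightarrow> bool" where
  "target C c t \<longleftrightarrow> t \<in> I - played C c \<and> (\<forall>i\<in>played C c. vx c i t \<in> C)"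

abbreviation unplayed :: "'v set \<Rightarrow> 'c \<Rightarrow> nat" where
  "unplayed C c \<equiv> card (I - played C c)"

lemma played_subset: "played C c \<subseteq> I"
  by (auto simp: played_def)

lemma played_insert:
  "\<lbrakk>i \<in> I; j \<in> I\<rbrakk> \<Longrightarrow> played (insert (vx c i j) C) c' = (if c' = c then insert i (played C c) else played C c')"
  by (auto simp: played_def)

lemma unplayed_insert:
  assumes "i \<in> I - played C c" "j \<in> I"
  shows "unplayed (insert (vx c i j) C) c + 1 = unplayed C c"
proof -
  have "I - played (insert (vx c i j) C) c = (I - played C c) - {i}"
    using assms by (auto simp: played_insert)
  then show ?thesis
    using assms(1) finite_I by (metis Suc_eq_plus1 card_Suc_Diff1 finite_Diff)
qed

lemma ex_other_unplayed:
  assumes "unplayed C c \<ge> 2"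
  obtains s where "s \<in> I - played C c" "s \<noteq> t"
proof -
  have "\<not> I - played C c \<subseteq> {t}"
    using assms card_mono[of "{t}" "I - played C c"] by auto
  then show thesis using that by blast
qed

lemma in_verts: "\<lbrakk>c \<in> Cs; i \<in> I; j \<in> I\<rbrakk> \<Longrightarrow> vx c i j \<in> pverts G"
  by (auto simp: verts_eq)

lemma played_dominated:
  "\<lbrakk>c \<in> Cs; i \<in> played C c; j \<in> I\<rbrakk> \<Longrightarrow> vx c i j \<in> dominated G C"
  by (auto simp: played_def dominated_def intro: same_clique)

lemma unplayed_dominated_iff:
  assumes "C \<subseteq> pverts G" "c \<in> Cs" "i \<in> I - played C c" "j \<in> I" "i \<noteq> j"
  shows "vx c i j \<in> dominated G C \<longleftrightarrow> vx c j i \<in> C"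
proof
  assume "vx c i j \<in> dominated G C"
  then obtain v where v: "v \<in> C" "vx c i j \<in> closed_neighbourhood G v"
    by (auto simp: dominated_def)
  then obtain c' a b where ab: "v = vx c' a b" "c' \<in> Cs" "a \<in> I" "b \<in> I"
    using assms(1) by (auto simp: verts_eq)
  have "c' = c"
    using other_copy[of c c' i j a b] v ab assms by auto
  moreover from this have "a \<noteq> i"
    using v(1) ab assms(3) by (auto simp: played_def)
  ultimately show "vx c j i \<in> C"
    using other_clique[of c i j a b] v ab assms by auto
next
  assume "vx c j i \<in> C"
  then show "vx c i j \<in> dominated G C"
    using other_clique[of c i j j i] assms by (auto simp: dominated_def)
qed

lemma dominated_mono: "C \<subseteq> C' \<Longrightarrow> dominated G C \<subseteq> dominated G C'"
  by (auto simp: dominated_def)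

lemma finished_mono: "\<lbrakk>finished C c; C \<subseteq> C'\<rbrakk> \<Longrightarrow> finished C' c"
  using dominated_mono[of C C'] by (auto simp: finished_def)

text \<open>If an unplayed clique is completely dominated, every other clique of the copy has been
  used to dominate a vertex of it, so all of them are played and the whole copy is dominated.\<close>

lemma unplayed_has_undominated:
  assumes C: "C \<subseteq> pverts G" and c: "c \<in> Cs" and "\<not> finished C c" and i: "i \<in> I - played C c"
  obtains j where "j \<in> I" "vx c i j \<notin> dominated G C"
proof (rule ccontr)
  assume "\<not> thesis"
  with that have all: "vx c i j \<in> dominated G C" if "j \<in> I" for j
    using that by blast
  have "vx c k j \<in> dominated G C" if "k \<in> I" "j \<in> I" for k j
  proof (cases "k = i")
    case False
    then have "vx c k i \<in> C"
      using unplayed_dominated_iff[OF C c i \<open>k \<in> I\<close>] all that by auto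
    then have "k \<in> played C c"
      using i that by (auto simp: played_def)
    then show ?thesis
      using played_dominated c that by blast
  qed (use all that in auto)
  then show False
    using assms(3) by (auto simp: finished_def)
qed

lemma undominated_unplayed:
  "\<lbrakk>c \<in> Cs; i \<in> I; j \<in> I; vx c i j \<notin> dominated G C\<rbrakk> \<Longrightarrow> i \<in> I - played C c \<and> \<not> finished C c"
  using played_dominated by (auto simp: finished_def)

lemma legal_iff:
  assumes "c \<in> Cs" "k \<in> I" "b \<in> I"
  shows "vx c k b \<in> legal_moves G C \<longleftrightarrow> (\<exists>c'\<in>Cs. \<exists>i\<in>I. \<exists>j\<in>I.
    vx c' i j \<in> closed_neighbourhood G (vx c k b) \<and> vx c' i j \<notin> dominated G C)"
proof -
  have "closed_neighbourhood G (vx c k b) \<subseteq> pverts G"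
    using in_verts[OF assms] wellformed(2) by (fastforce simp: closed_neighbourhood_def)
  then show ?thesis
    using in_verts[OF assms] by (fastforce simp: legal_moves_def verts_eq)
qed

lemma legal_in_unplayed:
  assumes "C \<subseteq> pverts G" "c \<in> Cs" "\<not> finished C c" "i \<in> I - played C c" "j \<in> I"
  shows "vx c i j \<in> legal_moves G C"
proof -
  obtain j' where "j' \<in> I" "vx c i j' \<notin> dominated G C"
    using unplayed_has_undominated assms by blast
  moreover have "vx c i j' \<in> closed_neighbourhood G (vx c i j)"
    using same_clique assms \<open>j' \<in> I\<close> by blast
  ultimately show ?thesis
    using assms by (subst legal_iff) auto
qed

lemma legal_into_unplayed:
  assumes "C \<subseteq> pverts G" "c \<in> Cs" "i \<in> I" "k \<in> I - played C c" "i \<noteq> k" "vx c i k \<notin> C"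
  shows "vx c i k \<in> legal_moves G C"
proof -
  have "vx c k i \<notin> dominated G C"
    using unplayed_dominated_iff[of C c k i] assms by auto
  moreover have "vx c k i \<in> closed_neighbourhood G (vx c i k)"
    using other_clique[of c k i i k] assms by auto
  ultimately show ?thesis
    using assms by (subst legal_iff) auto
qed

lemma ex_unfinished_if_legal:
  assumes "v \<in> legal_moves G C"
  shows "\<exists>c\<in>Cs. \<not> finished C c"
proof -
  obtain c k b where v: "v = vx c k b" "c \<in> Cs" "k \<in> I" "b \<in> I"
    using legal_move_in_verts[OF assms] by (auto simp: verts_eq)
  then show ?thesis
    using assms legal_iff[of c k b C] by (auto simp: finished_def)
qed

lemma ex_unplayed_if_unfinished:
  assumes "c \<in> Cs" "\<not> finished C c"
  obtains i where "i \<in> I - played C c"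
  using assms undominated_unplayed by (metis finished_def)

section \<open>Dominator's strategy\<close>

text \<open>An upper bound on the moves still to be charged to the copy \<open>c\<close>. Dominator always plays an
  unplayed clique, so two moves per unplayed clique suffice. A target \<open>t\<close> saves one: Dominator
  plays \<open>vx c i t\<close> in the other unplayed cliques, after which only the diagonal vertex of
  \<open>t\<close> may be undominated and a single move finishes the copy. If that vertex is dominated too,
  the target needs no move at all. A copy without any played clique is as good, for a first move
  that Staller makes towards it either plays a clique, which spares Dominator that clique, or
  dominates a diagonal vertex, which creates a target of the second kind.\<close>

definition upper_potential :: "'v set \<Rightarrow> 'c \<Rightarrow> nat" where
  "upper_potential C c = (if finished C c then 0
     else if played C c = {} \<or> (\<exists>t. target C c t \<and> vx c t t \<in> dominated G C) then 2 * unplayed C c - 2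
     else if \<exists>t. target C c t then 2 * unplayed C c - 1
     else 2 * unplayed C c)"

lemma upper_potential_le: "upper_potential C c \<le> 2 * unplayed C c"
  by (simp add: upper_potential_def)

lemma upper_potential_ge:
  "\<not> finished C c \<Longrightarrow> 2 * unplayed C c \<le> upper_potential C c + 2"
  by (auto simp: upper_potential_def)

lemma upper_potential_target:
  "target C c t \<Longrightarrow> upper_potential C c \<le> 2 * unplayed C c - 1"
  by (auto simp: upper_potential_def)

lemma upper_potential_strong_target:
  "\<lbrakk>target C c t; vx c t t \<in> dominated G C\<rbrakk> \<Longrightarrow> upper_potential C c \<le> 2 * unplayed C c - 2"
  by (auto simp: upper_potential_def)

lemma upper_potential_antimono:
  assumes "C \<subseteq> C'" "finished C c \<or> played C' c = played C c"
  shows "upper_potential C' c \<le> upper_potential C c"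
proof (cases "finished C' c")
  case False
  with assms finished_mono have nf: "\<not> finished C c" and P: "played C' c = played C c" by auto
  have target: "target C' c t" if "target C c t" for t
    using that assms(1) P by (auto simp: target_def)
  show ?thesis
  proof (cases "\<exists>t. target C c t \<and> vx c t t \<in> dominated G C")
    case True
    then have "\<exists>t. target C' c t \<and> vx c t t \<in> dominated G C'"
      using target dominated_mono[OF assms(1)] by blast
    then show ?thesis
      using nf False P True by (simp add: upper_potential_def)
  next
    case weak: False
    have old: "upper_potential C c = 2 * unplayed C c - (if played C c = {} then 2
        else if \<exists>t. target C c t then 1 else 0)"
      using weak nf by (auto simp: upper_potential_def)
    have new: "upper_potential C' c \<le> 2 * unplayed C c - (if played C c = {} then 2
        else if \<exists>t. target C' c t then 1 else 0)"
      using False P by (auto simp: upper_potential_def)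
    have "(\<exists>t. target C c t) \<Longrightarrow> (\<exists>t. target C' c t)" using target by blast
    then show ?thesis
      using old new by (auto split: if_splits)
  qed
qed (simp add: upper_potential_def)

lemma finished_if_strong_target_alone:
  assumes C: "C \<subseteq> pverts G" and c: "c \<in> Cs" and t: "target C c t"
    and tt: "vx c t t \<in> dominated G C" and alone: "I - played C c \<subseteq> {t}"
  shows "finished C c"
  unfolding finished_def
proof (intro ballI)
  fix i j assume ij: "i \<in> I" "j \<in> I"
  show "vx c i j \<in> dominated G C"
  proof (cases "i \<in> played C c \<or> j = t \<and> i = t")
    case False
    then have "i = t" "j \<in> played C c" using alone ij by auto
    then show ?thesis
      using unplayed_dominated_iff[OF C c, of t j] t ij False by (auto simp: target_def)
  qed (use played_dominated c ij tt in auto)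
qed

lemma upper_potential_pos:
  assumes C: "C \<subseteq> pverts G" and c: "c \<in> Cs" and nf: "\<not> finished C c"
  shows "upper_potential C c \<ge> 1"
proof -
  obtain i where i: "i \<in> I - played C c"
    using ex_unplayed_if_unfinished c nf by blast
  then have u: "unplayed C c \<ge> 1"
    using finite_I by (metis One_nat_def Suc_leI card_gt_0_iff empty_iff finite_Diff)
  have "unplayed C c \<ge> 2" if t: "target C c t" "vx c t t \<in> dominated G C" for t
  proof (rule ccontr)
    assume "\<not> unplayed C c \<ge> 2"
    then have "unplayed C c = 1" using u by linarith
    then obtain s where "I - played C c = {s}"
      using card_1_singletonE by blast
    then have "I - played C c \<subseteq> {t}"
      using t(1) by (auto simp: target_def)
    then show False using finished_if_strong_target_alone C c t nf by blast
  qed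
  then have u2: "unplayed C c \<ge> 2" if "played C c = {} \<or> (\<exists>t. target C c t \<and> vx c t t \<in> dominated G C)"
    using that card_I by auto
  show ?thesis
  proof (cases "played C c = {} \<or> (\<exists>t. target C c t \<and> vx c t t \<in> dominated G C)")
    case True
    then have "upper_potential C c = 2 * unplayed C c - 2"
      using nf by (simp add: upper_potential_def)
    then show ?thesis using u2[OF True] by simp
  next
    case False
    then have "upper_potential C c \<ge> 2 * unplayed C c - 1"
      using nf unfolding upper_potential_def by auto
    then show ?thesis using u by linarith
  qed
qed

lemma Dominator_feeds_target:
  assumes C: "C \<subseteq> pverts G" and c: "c \<in> Cs" and nf: "\<not> finished C c"
    and t: "target C c t" and i: "i \<in> I - played C c" "i \<noteq> t"
  shows "vx c i t \<in> legal_moves G C"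
    and "upper_potential (insert (vx c i t) C) c + 3 \<le> 2 * unplayed C c"
    and "vx c t t \<in> dominated G C \<Longrightarrow> upper_potential (insert (vx c i t) C) c + 4 \<le> 2 * unplayed C c"
proof -
  let ?C = "insert (vx c i t) C"
  have tI: "t \<in> I" using t by (simp add: target_def)
  show "vx c i t \<in> legal_moves G C"
    using legal_in_unplayed C c nf i tI by blast
  have t': "target ?C c t"
    using t i tI by (auto simp: target_def played_insert)
  have u: "unplayed ?C c + 1 = unplayed C c"
    using unplayed_insert i tI by blast
  have "unplayed ?C c \<ge> 1"
    using t' finite_I by (metis One_nat_def Suc_leI card_gt_0_iff empty_iff finite_Diff target_def)
  then show "upper_potential ?C c + 3 \<le> 2 * unplayed C c"
    and "vx c t t \<in> dominated G C \<Longrightarrow> upper_potential ?C c + 4 \<le> 2 * unplayed C c"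
    using u upper_potential_target[OF t'] upper_potential_strong_target[OF t']
      dominated_mono[of C ?C] by (auto simp: subset_iff)
qed

lemma Dominator_plays_unplayed:
  assumes "C \<subseteq> pverts G" "c \<in> Cs" "\<not> finished C c"
  obtains v where "v \<in> legal_moves G C" "\<exists>i\<in>I. \<exists>j\<in>I. v = vx c i j"
    "upper_potential (insert v C) c + 2 \<le> 2 * unplayed C c"
proof -
  obtain i where i: "i \<in> I - played C c"
    using ex_unplayed_if_unfinished assms by blast
  have "upper_potential (insert (vx c i i) C) c + 2 \<le> 2 * unplayed C c"
    using unplayed_insert[OF i, of i] i upper_potential_le[of "insert (vx c i i) C" c] by simp
  then show thesis
    using that[of "vx c i i"] legal_in_unplayed[OF assms i] i by blast
qed

text \<open>After a wasted move of Staller, one that dominates vertices of \<open>c\<close> without playing one of its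
  cliques, Dominator can answer in \<open>c\<close>: if the potential counts on a target, either
  one exists already, or the copy was unplayed and the clique whose diagonal vertex has just been
  dominated becomes one.\<close>

lemma Dominator_answers_waste:
  assumes C': "C' \<subseteq> pverts G" and c: "c \<in> Cs" and sub: "C \<subseteq> C'"
    and P: "played C' c = played C c" and nf: "\<not> finished C' c"
    and k: "k \<in> I" "j \<in> I" "vx c k j \<notin> dominated G C" "vx c k j \<in> dominated G C'"
  obtains v where "v \<in> legal_moves G C'" "\<exists>i\<in>I. \<exists>j\<in>I. v = vx c i j"
    "upper_potential (insert v C') c + 2 \<le> upper_potential C c"
proof -
  have C: "C \<subseteq> pverts G" using C' sub by blast
  have nf0: "\<not> finished C c" using nf finished_mono sub by blast
  have kP: "k \<in> I - played C c"
    using undominated_unplayed c k by blast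
  have target_mono: "target C' c t" if "target C c t" for t
    using that sub P by (auto simp: target_def)
  show thesis
  proof (cases "upper_potential C c = 2 * unplayed C c")
    case True
    then show thesis
      using that Dominator_plays_unplayed[OF C' c nf] P by metis
  next
    case False
    \<comment> \<open>Either the target is an old one, or no clique of the copy had been played.\<close>
    have "\<exists>t. target C' c t \<and> (target C c t \<or> played C c = {}) \<and>
      (vx c t t \<in> dominated G C' \<or> upper_potential C c + 1 = 2 * unplayed C c)"
    proof (cases "played C c = {}")
      case True
      have "k = j"
      proof (rule ccontr)
        assume "k \<noteq> j"
        then have "vx c j k \<in> C'"
          using unplayed_dominated_iff[OF C' c, of k j] kP k P by auto
        then have "j \<in> played C' c"
          using k kP by (auto simp: played_def)
        then show False using True P by simp
      qed
      then have "target C' c k \<and> vx c k k \<in> dominated G C'"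
        using k kP True P by (auto simp: target_def)
      then show ?thesis
        using True by blast
    next
      case notP: False
      show ?thesis
      proof (cases "\<exists>t. target C c t \<and> vx c t t \<in> dominated G C")
        case True
        then show ?thesis
          using target_mono dominated_mono[OF sub] by blast
      next
        case weak: False
        then obtain t where t: "target C c t"
          using False nf0 notP by (auto simp: upper_potential_def split: if_splits)
        then have "t \<in> I - played C c" by (simp add: target_def)
        then have "unplayed C c \<noteq> 0"
          using finite_I by auto
        then have "upper_potential C c + 1 = 2 * unplayed C c"
          using t weak notP nf0 by (auto simp: upper_potential_def)
        then show ?thesis
          using t target_mono by blast
      qed
    qed
    then obtain t where t: "target C' c t" and old: "target C c t \<or> played C c = {}"
      and good: "vx c t t \<in> dominated G C' \<or> upper_potential C c + 1 = 2 * unplayed C c" by blast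
    have "\<exists>i\<in>I - played C' c. i \<noteq> t"
    proof (rule ccontr)
      assume "\<not> ?thesis"
      then have alone: "I - played C' c \<subseteq> {t}" by blast
      then have "k = t" "j \<in> played C c \<or> j = t"
        using kP k(2) P by auto
      moreover have "j \<notin> played C c"
      proof
        assume j: "j \<in> played C c"
        then have "vx c j t \<in> C"
          using old by (auto simp: target_def)
        then show False
          using unplayed_dominated_iff[OF C c kP k(2)] \<open>k = t\<close> j kP k(3) by auto
      qed
      \<comment> \<open>So the wasted move has dominated the diagonal vertex of the target, the last one.\<close>
      ultimately have "vx c t t \<in> dominated G C'" using k by simp
      then show False
        using finished_if_strong_target_alone[OF C' c t _ alone] nf by blast
    qed
    then obtain i where i: "i \<in> I - played C' c" "i \<noteq> t" by blast
    have "upper_potential (insert (vx c i t) C') c + 2 \<le> upper_potential C c"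
      using Dominator_feeds_target(2,3)[OF C' c nf t i] good upper_potential_ge[OF nf0] P by auto
    then show thesis
      using that[of "vx c i t"] Dominator_feeds_target(1)[OF C' c nf t i] i t
      by (auto simp: target_def)
  qed
qed

text \<open>Any move in an unplayed clique lowers the potential unless the potential is as low as the
  number of unplayed cliques permits. In that case there is a target to play for, since in an
  unplayed copy every clique is one.\<close>

lemma Dominator_free_move:
  assumes C: "C \<subseteq> pverts G" and c: "c \<in> Cs" and nf: "\<not> finished C c"
  obtains v where "v \<in> legal_moves G C" "\<exists>i\<in>I. \<exists>j\<in>I. v = vx c i j"
    "upper_potential (insert v C) c + 1 \<le> upper_potential C c"
proof (cases "upper_potential C c + 2 = 2 * unplayed C c")
  case True
  then have u: "unplayed C c \<ge> 2"
    using upper_potential_pos[OF assms] by linarith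
  have "\<exists>t. target C c t"
  proof (cases "played C c = {}")
    case True
    obtain t where "t \<in> I" using card_I by fastforce
    then show ?thesis using True by (auto simp: target_def)
  next
    case False
    then show ?thesis using True u nf by (auto simp: upper_potential_def split: if_splits)
  qed
  then obtain t where t: "target C c t" by blast
  obtain i where i: "i \<in> I - played C c" "i \<noteq> t"
    using ex_other_unplayed u by blast
  show thesis
    using that[of "vx c i t"] Dominator_feeds_target(1,2)[OF C c nf t i] True i t
    by (auto simp: target_def)
next
  case False
  obtain v where "v \<in> legal_moves G C" "\<exists>i\<in>I. \<exists>j\<in>I. v = vx c i j"
    "upper_potential (insert v C) c + 2 \<le> 2 * unplayed C c"
    using Dominator_plays_unplayed[OF assms] by blast
  then show thesis
    using that[of v] False upper_potential_ge[OF nf] by linarith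
qed

lemma sum_drop:
  fixes f g :: "'c \<Rightarrow> nat"
  assumes "c \<in> Cs" "g c + d \<le> f c" "\<And>c'. \<lbrakk>c' \<in> Cs; c' \<noteq> c\<rbrakk> \<Longrightarrow> g c' \<le> f c'"
  shows "sum g Cs + d \<le> sum f Cs"
proof -
  have "sum g (Cs - {c}) \<le> sum f (Cs - {c})"
    using assms(3) by (intro sum_mono) auto
  then show ?thesis
    using assms(2) sum.remove[OF finite_Cs assms(1), of f] sum.remove[OF finite_Cs assms(1), of g]
    by linarith
qed

lemma total_upper_free:
  assumes "C \<subseteq> pverts G" "legal_moves G C \<noteq> {}"
  shows "\<exists>v\<in>legal_moves G C. sum (upper_potential (insert v C)) Cs + 1 \<le> sum (upper_potential C) Cs"
proof -
  obtain c where c: "c \<in> Cs" "\<not> finished C c"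
    using ex_unfinished_if_legal assms(2) by blast
  obtain v i j where v: "v \<in> legal_moves G C" "v = vx c i j" "i \<in> I" "j \<in> I"
    "upper_potential (insert v C) c + 1 \<le> upper_potential C c"
    using Dominator_free_move[OF assms(1) c] by metis
  have "sum (upper_potential (insert v C)) Cs + 1 \<le> sum (upper_potential C) Cs"
    using c v by (intro sum_drop[of c] upper_potential_antimono) (auto simp: played_insert)
  then show ?thesis using v(1) by blast
qed

text \<open>Staller's move need not be charged to the copy in which it is made: on the diagonal it may
  dominate a vertex of another copy.\<close>

lemma total_upper_reply:
  assumes C: "C \<subseteq> pverts G" and v: "v \<in> legal_moves G C" and go: "legal_moves G (insert v C) \<noteq> {}"
  shows "\<exists>w\<in>legal_moves G (insert v C).
    sum (upper_potential (insert w (insert v C))) Cs + 2 \<le> sum (upper_potential C) Cs"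
proof -
  let ?C = "insert v C"
  obtain c k b where vx: "v = vx c k b" "c \<in> Cs" "k \<in> I" "b \<in> I"
    using legal_move_in_verts[OF v] by (auto simp: verts_eq)
  have C': "?C \<subseteq> pverts G" using C legal_move_in_verts[OF v] by simp
  \<comment> \<open>The copy charged is the move's own if it plays a new clique there, and otherwise the one
    in which it dominates something.\<close>
  have "\<exists>d\<in>Cs. \<not> finished C d \<and>
      (\<forall>c'\<in>Cs. c' \<noteq> d \<longrightarrow> finished C c' \<or> played ?C c' = played C c') \<and>
      (\<not> finished ?C d \<longrightarrow> (\<exists>w\<in>legal_moves G ?C. (\<exists>i\<in>I. \<exists>j\<in>I. w = vx d i j) \<and>
        upper_potential (insert w ?C) d + 2 \<le> upper_potential C d))"
  proof (cases "finished C c \<or> k \<in> played C c")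
    case False
    have "\<exists>w\<in>legal_moves G ?C. (\<exists>i\<in>I. \<exists>j\<in>I. w = vx c i j) \<and>
        upper_potential (insert w ?C) c + 2 \<le> upper_potential C c" if nf: "\<not> finished ?C c"
    proof -
      obtain w where w: "w \<in> legal_moves G ?C" "\<exists>i\<in>I. \<exists>j\<in>I. w = vx c i j"
        "upper_potential (insert w ?C) c + 2 \<le> 2 * unplayed ?C c"
        using Dominator_plays_unplayed[OF C' vx(2) nf] by blast
      have "unplayed ?C c + 1 = unplayed C c"
        using unplayed_insert[of k C c b] vx False by simp
      then show ?thesis
        using w upper_potential_ge[of C c] False by (intro bexI[of _ w]) auto
    qed
    then show ?thesis
      using False vx by (intro bexI[of _ c]) (auto simp: played_insert)
  next
    case True
    have P: "finished C c' \<or> played ?C c' = played C c'" for c'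
      using True vx by (auto simp: played_insert)
    obtain d i j where d: "d \<in> Cs" "i \<in> I" "j \<in> I"
      "vx d i j \<in> closed_neighbourhood G v" "vx d i j \<notin> dominated G C"
      using v vx legal_iff[of c k b C] by blast
    then have nf: "\<not> finished C d" by (auto simp: finished_def)
    have "\<exists>w\<in>legal_moves G ?C. (\<exists>i\<in>I. \<exists>j\<in>I. w = vx d i j) \<and>
        upper_potential (insert w ?C) d + 2 \<le> upper_potential C d" if nf': "\<not> finished ?C d"
    proof -
      have "vx d i j \<in> dominated G ?C" using d by (auto simp: dominated_def)
      then show ?thesis
        using Dominator_answers_waste[OF C' d(1) _ _ nf' d(2,3,5)] P nf by (metis subset_insertI)
    qed
    then show ?thesis using nf d P by blast
  qed
  then obtain d where d: "d \<in> Cs" "\<not> finished C d"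
    and P: "\<And>c'. \<lbrakk>c' \<in> Cs; c' \<noteq> d\<rbrakk> \<Longrightarrow> finished C c' \<or> played ?C c' = played C c'"
    and answer: "\<not> finished ?C d \<Longrightarrow> \<exists>w\<in>legal_moves G ?C. (\<exists>i\<in>I. \<exists>j\<in>I. w = vx d i j) \<and>
        upper_potential (insert w ?C) d + 2 \<le> upper_potential C d" by blast
  show ?thesis
  proof (cases "finished ?C d")
    case True
    then have "upper_potential ?C d = 0" by (simp add: upper_potential_def)
    then have "sum (upper_potential ?C) Cs + 1 \<le> sum (upper_potential C) Cs"
      using d P upper_potential_pos[OF C d]
      by (intro sum_drop[of d] upper_potential_antimono) auto
    moreover obtain w where "w \<in> legal_moves G ?C"
      "sum (upper_potential (insert w ?C)) Cs + 1 \<le> sum (upper_potential ?C) Cs"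
      using total_upper_free[OF C' go] by blast
    ultimately show ?thesis by (intro bexI[of _ w]) linarith
  next
    case False
    then obtain w i j where w: "w \<in> legal_moves G ?C" "w = vx d i j" "i \<in> I" "j \<in> I"
      "upper_potential (insert w ?C) d + 2 \<le> upper_potential C d"
      using answer by blast
    have "sum (upper_potential (insert w ?C)) Cs + 2 \<le> sum (upper_potential C) Cs"
      using d P w by (intro sum_drop[of d] upper_potential_antimono) (auto simp: played_insert)
    then show ?thesis using w(1) by blast
  qed
qed

lemma optimal_moves_upper:
  "optimal_moves G P {} \<le> card Cs * (2 * card I - 2)"
proof -
  have "optimal_moves G P {} \<le> sum (upper_potential {}) Cs"
    by (rule optimal_moves_le_potential[OF finite_verts total_upper_free total_upper_reply]) auto
  also have "\<dots> \<le> (\<Sum>c\<in>Cs. 2 * card I - 2)"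
    by (intro sum_mono) (auto simp: upper_potential_def played_def)
  finally show ?thesis by simp
qed

section \<open>Staller's strategy\<close>

text \<open>A lower bound on the moves still to be charged to the copy \<open>c\<close>. Staller wastes moves: each
  move \<open>vx c i k\<close> from a played clique \<open>i\<close> into an unplayed clique \<open>k\<close> dominates a single
  vertex and leaves every unplayed clique unplayed. Thus two moves pass per played clique, as
  long as two unplayed cliques remain. A target is bad for Staller, as no wasted move into it is
  left until another clique gets played. Finished copies have at most one unplayed clique, so
  their potential vanishes. Diagonal vertices are disregarded, so that moves in one copy cannot
  affect the potential of another.\<close>

definition lower_potential :: "'v set \<Rightarrow> 'c \<Rightarrow> nat" where
  "lower_potential C c = 2 * unplayed C c - (if \<exists>t. target C c t then 3 else 2)"

lemma lower_potential_ge: "2 * unplayed C c \<le> lower_potential C c + 3"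
  unfolding lower_potential_def by (split if_split) linarith

lemma lower_potential_le: "lower_potential C c \<le> 2 * unplayed C c - 2"
  unfolding lower_potential_def by (split if_split) linarith

lemma lower_potential_no_target:
  "(\<And>t. \<not> target C c t) \<Longrightarrow> lower_potential C c = 2 * unplayed C c - 2"
  by (simp add: lower_potential_def)

lemma lower_potential_other_copy:
  assumes "i \<in> I" "j \<in> I" "c \<noteq> c'"
  shows "lower_potential (insert (vx c i j) C) c' = lower_potential C c'"
  using assms by (simp add: lower_potential_def target_def played_insert)

lemma legal_if_two_unplayed:
  assumes "C \<subseteq> pverts G" "c \<in> Cs" "unplayed C c \<ge> 2" "i \<in> I - played C c" "j \<in> I"
  shows "vx c i j \<in> legal_moves G C"
proof -
  obtain s where s: "s \<in> I - played C c" "s \<noteq> i"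
    using ex_other_unplayed assms(3) by blast
  then have "vx c i s \<notin> dominated G C"
    using unplayed_dominated_iff[of C c i s] assms by (auto simp: played_def)
  then show ?thesis
    using legal_in_unplayed[OF assms(1,2) _ assms(4,5)] assms s by (auto simp: finished_def)
qed

text \<open>If no move can be wasted in the copy, Staller plays a diagonal vertex of an unplayed clique:
  it dominates no vertex of another clique of the copy and thereby destroys all targets.\<close>

lemma Staller_free_move:
  assumes C: "C \<subseteq> pverts G" and c: "c \<in> Cs" and pos: "lower_potential C c > 0"
  obtains v where "v \<in> legal_moves G C" "\<exists>i\<in>I. \<exists>j\<in>I. v = vx c i j"
    "lower_potential C c \<le> lower_potential (insert v C) c + 1"
proof -
  have u: "unplayed C c \<ge> 2"
    using pos lower_potential_le[of C c] by linarith
  show thesis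
  proof (cases "\<exists>k\<in>I - played C c. \<exists>i\<in>played C c. vx c i k \<notin> C")
    case True
    then obtain k i where ki: "k \<in> I - played C c" "i \<in> played C c" "vx c i k \<notin> C" by blast
    then have iI: "i \<in> I" using played_subset by blast
    have "played (insert (vx c i k) C) c = played C c"
      using ki iI by (auto simp: played_insert)
    then have "lower_potential C c \<le> lower_potential (insert (vx c i k) C) c + 1"
      using lower_potential_ge[of "insert (vx c i k) C" c] lower_potential_le[of C c] u by simp
    moreover have "vx c i k \<in> legal_moves G C"
      using legal_into_unplayed C c ki iI by blast
    ultimately show thesis using that ki iI by blast
  next
    case False
    obtain r where r: "r \<in> I - played C c" using ex_other_unplayed u by blast
    let ?C = "insert (vx c r r) C"
    have "\<not> target ?C c t" for t
      using r by (auto simp: target_def played_insert) (auto simp: played_def)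
    then have "lower_potential ?C c = 2 * unplayed ?C c - 2"
      by (rule lower_potential_no_target)
    moreover have "target C c r"
      using False r by (auto simp: target_def)
    then have "lower_potential C c = 2 * unplayed C c - 3"
      by (auto simp: lower_potential_def)
    ultimately have "lower_potential C c \<le> lower_potential ?C c + 1"
      using unplayed_insert[OF r, of r] r by simp
    then show thesis
      using that[of "vx c r r"] legal_if_two_unplayed[OF C c u r] r by blast
  qed
qed

text \<open>The clique that Dominator has just played offers new moves to waste, and Staller makes one
  of them. If there was no target, a wasted move from an older clique into each unplayed clique
  is still available, so using up a new one creates no target. When Dominator's move has left
  only one unplayed clique, the potential is spent and any wasted move will do.\<close>

lemma Staller_answer:
  assumes C: "C \<subseteq> pverts G" and c: "c \<in> Cs" and k: "k \<in> I - played C c" and b: "b \<in> I"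
    and big: "lower_potential C c \<ge> 2"
  obtains w where "w \<in> legal_moves G (insert (vx c k b) C)" "\<exists>i\<in>I. \<exists>j\<in>I. w = vx c i j"
    "lower_potential C c \<le> lower_potential (insert w (insert (vx c k b) C)) c + 2"
proof -
  let ?C = "insert (vx c k b) C"
  have C': "?C \<subseteq> pverts G" using C c k b in_verts by auto
  have P: "played ?C c = insert k (played C c)"
    using k b by (simp add: played_insert)
  have u1: "unplayed ?C c + 1 = unplayed C c"
    using unplayed_insert k b by blast
  show thesis
  proof (cases "unplayed C c \<ge> 3")
    case True
    then obtain t where t: "t \<in> I - played ?C c" "t \<noteq> b"
      using ex_other_unplayed[of ?C c b] u1 by auto
    let ?w = "vx c k t"
    have legal: "?w \<in> legal_moves G ?C"
      using legal_into_unplayed[OF C' c _ t(1), of k] t k P by (auto simp: played_def)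
    have P2: "played (insert ?w ?C) c = played ?C c"
      using k t P by (auto simp: played_insert)
    have "lower_potential C c \<le> lower_potential (insert ?w ?C) c + 2"
    proof (cases "\<exists>s. target C c s")
      case True
      then have "lower_potential C c = 2 * unplayed C c - 3" by (simp add: lower_potential_def)
      then show ?thesis
        using lower_potential_ge[of "insert ?w ?C" c] u1 P2 by simp
    next
      case False
      have "\<not> target (insert ?w ?C) c s" for s
      proof
        assume s: "target (insert ?w ?C) c s"
        then have "s \<in> I - played C c" using P P2 by (auto simp: target_def)
        then obtain l where "l \<in> played C c" "vx c l s \<notin> C"
          using False by (auto simp: target_def)
        then show False using s P P2 k by (auto simp: target_def)
      qed
      then have "lower_potential (insert ?w ?C) c = 2 * unplayed (insert ?w ?C) c - 2"
        by (rule lower_potential_no_target)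
      then show ?thesis
        using lower_potential_le[of C c] u1 P2 by simp
    qed
    then show thesis using that[of ?w] legal k t by blast
  next
    case False
    then have low: "lower_potential C c \<le> 2" "\<not> (\<exists>s. target C c s)" "unplayed C c \<ge> 2"
      using big lower_potential_le[of C c] by (auto simp: lower_potential_def split: if_splits)
    obtain t where t: "t \<in> I - played C c" "t \<noteq> k"
      using ex_other_unplayed low(3) by blast
    then obtain l where l: "l \<in> played C c" "vx c l t \<notin> C"
      using low(2) by (auto simp: target_def)
    have "vx c l t \<in> legal_moves G ?C"
      using legal_into_unplayed[OF C' c, of l t] l t k P played_subset by auto
    then show thesis
      using that[of "vx c l t"] l t low(1) played_subset by fastforce
  qed
qed

lemma sum_loss:
  fixes f g :: "'c \<Rightarrow> nat"
  assumes "c \<in> Cs" "f c \<le> g c + d" "\<And>c'. \<lbrakk>c' \<in> Cs; c' \<noteq> c\<rbrakk> \<Longrightarrow> f c' \<le> g c'"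
  shows "sum f Cs \<le> sum g Cs + d"
proof -
  have "sum f (Cs - {c}) \<le> sum g (Cs - {c})"
    using assms(3) by (intro sum_mono) auto
  then show ?thesis
    using assms(2) sum.remove[OF finite_Cs assms(1), of f] sum.remove[OF finite_Cs assms(1), of g]
    by linarith
qed

lemma total_lower_free:
  assumes C: "C \<subseteq> pverts G" and pos: "sum (lower_potential C) Cs > 0"
  shows "\<exists>v\<in>legal_moves G C. sum (lower_potential C) Cs \<le> sum (lower_potential (insert v C)) Cs + 1"
proof -
  obtain c where c: "c \<in> Cs" "lower_potential C c > 0"
    using pos finite_Cs by (metis gr0I less_irrefl sum.neutral)
  obtain v i j where v: "v \<in> legal_moves G C" "v = vx c i j" "i \<in> I" "j \<in> I"
    "lower_potential C c \<le> lower_potential (insert v C) c + 1"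
    using Staller_free_move[OF C c] by metis
  have "sum (lower_potential C) Cs \<le> sum (lower_potential (insert v C)) Cs + 1"
    using v c by (intro sum_loss[of c]) (auto simp: lower_potential_other_copy)
  then show ?thesis using v(1) by blast
qed

lemma total_lower_reply:
  assumes C: "C \<subseteq> pverts G" and v: "v \<in> legal_moves G C" and big: "sum (lower_potential C) Cs > 1"
  shows "\<exists>w\<in>legal_moves G (insert v C).
    sum (lower_potential C) Cs \<le> sum (lower_potential (insert w (insert v C))) Cs + 2"
proof -
  obtain c k b where vx: "v = vx c k b" "c \<in> Cs" "k \<in> I" "b \<in> I"
    using legal_move_in_verts[OF v] by (auto simp: verts_eq)
  let ?C = "insert v C"
  have C': "?C \<subseteq> pverts G" using C legal_move_in_verts[OF v] by simp
  show ?thesis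
  proof (cases "k \<in> played C c \<or> lower_potential C c \<le> 1")
    case True
    \<comment> \<open>A move that Dominator wastes can at worst create a target, so Staller may move anywhere.\<close>
    have "lower_potential C c \<le> lower_potential ?C c + 1"
    proof (cases "k \<in> played C c")
      case True
      then have "played ?C c = played C c" using vx by (auto simp: played_insert)
      then show ?thesis
        using lower_potential_ge[of ?C c] lower_potential_le[of C c] by simp
    qed (use True in auto)
    then have drop: "sum (lower_potential C) Cs \<le> sum (lower_potential ?C) Cs + 1"
      using vx by (intro sum_loss[of c]) (auto simp: lower_potential_other_copy)
    then have "sum (lower_potential ?C) Cs > 0" using big by linarith
    then obtain w where "w \<in> legal_moves G ?C"
      "sum (lower_potential ?C) Cs \<le> sum (lower_potential (insert w ?C)) Cs + 1"
      using total_lower_free[OF C'] by blast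
    then show ?thesis using drop by (intro bexI[of _ w]) linarith
  next
    case False
    then obtain w i j where w: "w \<in> legal_moves G ?C" "w = vx c i j" "i \<in> I" "j \<in> I"
      "lower_potential C c \<le> lower_potential (insert w ?C) c + 2"
      using Staller_answer[OF C vx(2) _ vx(4), of k] vx(1,3) False
      by (metis DiffI One_nat_def Suc_1 Suc_leI not_le)
    have "sum (lower_potential C) Cs \<le> sum (lower_potential (insert w ?C)) Cs + 2"
      using w vx by (intro sum_loss[of c]) (auto simp: lower_potential_other_copy)
    then show ?thesis using w(1) by blast
  qed
qed

lemma optimal_moves_lower:
  "card Cs * (2 * card I - 3) \<le> optimal_moves G P {}"
proof -
  have "card Cs * (2 * card I - 3) = (\<Sum>c\<in>Cs. 2 * card I - 3)" by simp
  also have "\<dots> \<le> sum (lower_potential {}) Cs"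
    by (intro sum_mono) (auto simp: lower_potential_def played_def)
  also have "\<dots> \<le> optimal_moves G P {}"
    by (rule optimal_moves_ge_potential[OF finite_verts total_lower_free total_lower_reply]) auto
  finally show ?thesis .
qed

end

section \<open>Sierpinski graphs\<close>

lemma adjacent_same_copy:
  assumes "length c = m"
  shows "sierpinski_adj (Suc (Suc m)) (c @ [i, j]) (c @ [i', j'])
    \<longleftrightarrow> i = i' \<and> j \<noteq> j' \<or> i \<noteq> i' \<and> i = j' \<and> j = i'"
proof -
  have pre: "(c @ [i, j]) ! t = (c @ [i', j']) ! t" if "t < m" for t
    using that assms by (simp add: nth_append)
  have last: "(c @ [x, y]) ! m = x" "(c @ [x, y]) ! Suc m = y" for x y
    using assms by (auto simp: nth_append)
  let ?u = "c @ [i, j]" and ?v = "c @ [i', j']"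
  define Q where "Q h \<longleftrightarrow> (\<forall>t<h. ?u ! t = ?v ! t) \<and> ?u ! h \<noteq> ?v ! h \<and>
    (\<forall>t. h < t \<and> t < Suc (Suc m) \<longrightarrow> ?u ! t = ?v ! h \<and> ?v ! t = ?u ! h)" for h
  have "(\<forall>t. m < t \<and> t < Suc (Suc m) \<longrightarrow> R t) \<longleftrightarrow> R (Suc m)" for R
    by (metis lessI less_antisym not_less_eq)
  then have "Q m \<longleftrightarrow> i \<noteq> i' \<and> j = i' \<and> j' = i"
    unfolding Q_def using pre by (simp add: last)
  moreover have "Q (Suc m) \<longleftrightarrow> i = i' \<and> j \<noteq> j'"
    unfolding Q_def using pre by (auto simp: last less_Suc_eq)
  moreover have "\<not> Q h" if "h < m" for h
    using that pre by (auto simp: Q_def)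
  then have "(\<exists>h<Suc (Suc m). Q h) \<longleftrightarrow> Q m \<or> Q (Suc m)"
    by (auto simp: less_Suc_eq)
  ultimately show ?thesis
    unfolding sierpinski_adj_def Q_def[symmetric] by auto
qed

lemma adjacent_other_copy:
  assumes "length c = m" "length c' = m" "c \<noteq> c'"
    and "sierpinski_adj (Suc (Suc m)) (c' @ [i', j']) (c @ [i, j])"
  shows "i = j"
proof -
  obtain h where h: "\<forall>t<h. (c' @ [i', j']) ! t = (c @ [i, j]) ! t"
    "\<And>t. h < t \<Longrightarrow> t < Suc (Suc m) \<Longrightarrow> (c @ [i, j]) ! t = (c' @ [i', j']) ! h"
    using assms(4) by (auto simp: sierpinski_adj_def)
  obtain t where t: "t < m" "c ! t \<noteq> c' ! t"
    using assms(1-3) by (metis nth_equalityI)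
  then have "(c' @ [i', j']) ! t \<noteq> (c @ [i, j]) ! t"
    using assms(1,2) by (simp add: nth_append)
  then have "h < m"
    using h(1) t by (metis leI order_le_less_trans not_less_iff_gr_or_eq)
  then show ?thesis
    using h(2)[of m] h(2)[of "Suc m"] assms(1) by (simp add: nth_append)
qed

lemma verts_sierpinski_graph:
  "pverts (sierpinski_graph p (Suc (Suc m))) = {c @ [i, j] | c i j.
     c \<in> {c. set c \<subseteq> {1..p} \<and> length c = m} \<and> i \<in> {1..p} \<and> j \<in> {1..p}}"
proof (rule set_eqI, rule iffI)
  fix w assume "w \<in> pverts (sierpinski_graph p (Suc (Suc m)))"
  then have w: "length w = Suc (Suc m)" "set w \<subseteq> {1..p}"
    by (auto simp: sierpinski_graph_def)
  have "w = take m w @ [w ! m, w ! Suc m]"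
    using w(1) by (metis append.assoc append_Cons append_Nil lessI less_Suc_eq order_refl take_Suc_conv_app_nth take_all)
  moreover have "set (take m w) \<subseteq> {1..p}" "length (take m w) = m" "w ! m \<in> {1..p}" "w ! Suc m \<in> {1..p}"
    using w set_take_subset[of m w] subsetD[OF w(2) nth_mem, of m] subsetD[OF w(2) nth_mem, of "Suc m"]
    by (blast, auto)
  ultimately show "w \<in> {c @ [i, j] | c i j.
     c \<in> {c. set c \<subseteq> {1..p} \<and> length c = m} \<and> i \<in> {1..p} \<and> j \<in> {1..p}}"
    by blast
qed (auto simp: sierpinski_graph_def)

lemma sierpinski_copies_sierpinski_graph:
  assumes "p \<ge> 3"
  shows "sierpinski_copies (sierpinski_graph p (Suc (Suc m)))
    {c. set c \<subseteq> {1..p} \<and> length c = m} {1..p} (\<lambda>c i j. c @ [i, j])"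
proof -
  let ?G = "sierpinski_graph p (Suc (Suc m))"
  let ?Cs = "{c. set c \<subseteq> {1..p} \<and> length c = m}"
  interpret pair_graph ?G by (rule pair_graph_sierpinski_graph)
  have nbh: "c @ [i, j] \<in> closed_neighbourhood ?G (c' @ [i', j']) \<longleftrightarrow>
      c = c' \<and> i = i' \<and> j = j' \<or> sierpinski_adj (Suc (Suc m)) (c' @ [i', j']) (c @ [i, j])"
    if "c \<in> ?Cs" "c' \<in> ?Cs" "i \<in> {1..p}" "j \<in> {1..p}" "i' \<in> {1..p}" "j' \<in> {1..p}" for c c' i j i' j'
    using that by (auto simp: closed_neighbourhood_def sierpinski_graph_def)
  show ?thesis
  proof
    show "finite ?Cs" by (simp add: finite_lists_length_eq)
    show "card {1..p} \<ge> 3" using assms by simp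
    show "pverts ?G = {c @ [i, j] | c i j. c \<in> ?Cs \<and> i \<in> {1..p} \<and> j \<in> {1..p}}"
      by (rule verts_sierpinski_graph)
  next
    fix c i j j' assume "c \<in> ?Cs" "i \<in> {1..p}" "j \<in> {1..p}" "j' \<in> {1..p}"
    then show "c @ [i, j] \<in> closed_neighbourhood ?G (c @ [i, j'])"
      by (auto simp: nbh adjacent_same_copy)
  next
    fix c i j i' j' assume "c \<in> ?Cs" "i \<in> {1..p}" "j \<in> {1..p}" "i' \<in> {1..p}" "j' \<in> {1..p}" "i \<noteq> i'"
    then show "c @ [i, j] \<in> closed_neighbourhood ?G (c @ [i', j']) \<longleftrightarrow> j = i' \<and> j' = i"
      by (auto simp: nbh adjacent_same_copy)
  next
    fix c c' i j i' j'
    assume "c \<in> ?Cs" "c' \<in> ?Cs" "i \<in> {1..p}" "j \<in> {1..p}" "i' \<in> {1..p}" "j' \<in> {1..p}"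
      "c \<noteq> c'" "c @ [i, j] \<in> closed_neighbourhood ?G (c' @ [i', j'])"
    then show "i = j"
      using nbh adjacent_other_copy[of c m c' i' j' i j] by auto
  qed auto
qed

theorem theorem3p3:
  fixes p n :: nat
  assumes "p \<ge> 3" and "n \<ge> 2"
  shows "(2 * p - 3) * p ^ (n - 2) \<le> game_domination_number (sierpinski_graph p n) \<and>
         game_domination_number (sierpinski_graph p n) \<le> (2 * p - 2) * p ^ (n - 2) \<and>
         (2 * p - 3) * p ^ (n - 2) \<le> staller_start_game_domination_number (sierpinski_graph p n) \<and>
         staller_start_game_domination_number (sierpinski_graph p n) \<le> (2 * p - 2) * p ^ (n - 2)"
proof -
  define m where "m = n - 2"
  then have n: "n = Suc (Suc m)" using assms(2) by simp
  interpret sierpinski_copies "sierpinski_graph p (Suc (Suc m))"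
    "{c. set c \<subseteq> {1..p} \<and> length c = m}" "{1..p}" "\<lambda>c i j. c @ [i, j]"
    using assms(1) by (rule sierpinski_copies_sierpinski_graph)
  have "card {c. set c \<subseteq> {1..p} \<and> length c = m} = p ^ m"
    by (simp add: card_lists_length_eq)
  then show ?thesis
    using optimal_moves_lower optimal_moves_upper
    unfolding game_domination_number_def staller_start_game_domination_number_def n
    by (simp add: mult.commute)
qed

end
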